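(* In the theory $\mathcal{Q}\#$: for every $m$-atom $x$, $qc([x])=_E 1$.
   Context: Quasi-set theory $\mathcal{Q}$ is a first-order theory in classical logic with no primitive equality symbol. Primitive symbols: unary predicates $m$ ("$x$ is an $m$-atom"), $M$ ("$x$ is an $M$-atom"), $Z$ ("$x$ is a set"); binary predicates $\equiv$ (indistinguishability) and $\in$; a unary function symbol $qc$ (quasi-cardinal). Abbreviations: $Q(x):=\neg(m(x)\vee M(x))$ ("$x$ is a qset"); $D(x):=M(x)\vee Z(x)$; $E(x):=Q(x)\wedge\forall y(y\in x\Rightarrow Q(y))$; $x=_E y:=(Q(x)\wedge Q(y)\wedge\forall z(z\in x\Leftrightarrow z\in y))\vee(M(x)\wedge M(y)\wedge\forall z(Q(z)\Rightarrow(x\in z\Leftrightarrow y\in z)))$ (extensional identity), $x\neq_E y:=\neg(x=_E y)$; $x\subseteq y:=\forall z(z\in x\Rightarrow z\in y)$; $x\subset y:=x\subseteq y\wedge x\neq_E y$; $\forall_Q,\exists_Q,\forall_D$ are quantifiers relativized to $Q$, $D$. Axioms of $\mathcal{Q}$: (Q1)–(Q3) $\equiv$ is reflexive, symmetric and transitive. (Q4) $\forall x\forall y(x=_E y\Rightarrow(A(x,x)\Rightarrow A(x,y)))$ for every formula $A$, with $A(x,y)$ obtained by replacing some free occurrences of $x$ by $y$, $y$ free for $x$. (Q5) $\forall x\,\neg(m(x)\wedge M(x))$. (Q6) $\forall x\forall y(x\in y\Rightarrow Q(y))$. (Q7) $\forall x(Z(x)\Rightarrow Q(x))$. (Q8)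 $\forall_Q x(\forall y(y\in x\Rightarrow D(y))\Leftrightarrow Z(x))$. (Q9) $\forall x\forall y(m(x)\wedge x\equiv y\Rightarrow m(y))$, $\forall x\forall y(x=_E y\wedge M(x)\Rightarrow M(y))$, $\forall x\forall y(x=_E y\wedge Z(x)\Rightarrow Z(y))$. (Q10) $\exists_Q x\forall y\,\neg(y\in x)$; such a qset is written $\emptyset$. (Q11) $\forall_D x\forall_D y(x\equiv y\Rightarrow x=_E y)$. (Q12) $\forall x\forall y\exists_Q z\forall t(t\in z\Leftrightarrow t\equiv x\vee t\equiv y)$; this qset is written $[x,y]$, and $[x]:=[x,x]$. (Q13) Separation: for each formula $A(t)$ without $y$ free, $\forall_Q x\exists_Q y\forall t(t\in y\Leftrightarrow t\in x\wedge A(t))$; written $[t\in x:A(t)]$. (Q14) $\forall_Q x(E(x)\Rightarrow\exists_Q y\forall z(z\in y\Leftrightarrow\exists t(z\in t\wedge t\in x)))$; written $\bigcup_{t\in x}t$. For qsets $x,y$, $x\cup y$, $x\cap y$, $x-y$ denote the qsets whose elements are exactly the objects in $x$ or in $y$, in both, in $x$ but not in $y$, respectively. (Q15) $\forall_Q x\exists_Q y\forall t(t\in y\Leftrightarrow t\subseteq x)$; written $\mathcal{P}(x)$. Also $\langle x,y\rangle:=[[x],[x,y]]$. (Q16) $\exists_Q x(\emptyset\in x\wedge\forall y(y\in x\wedge Q(y)\Rightarrow y\cup[y]\in x))$. (Q17) $\forall_Q x(E(x)\wedge x\neq_E\emptyset\Rightarrow\exists_Q y(y\in x\wedge y\cap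 x=_E\emptyset))$. The objects satisfying $D$ (with $\in$ and $=_E$) form a copy of ZFU set theory inside $\mathcal{Q}$; in it cardinals, natural numbers ($0,1,\dots$), cardinal arithmetic ($+,\le,<,2^\kappa$) and the cardinal $card(x)$ of a set are defined as usual; $Fin(x)$ means $qc(x)$ is a natural number. (Q18) $\forall x(\neg Q(x)\Rightarrow qc(x)=_E 0)$. (Q19) for every qset $x$, $qc(x)$ is a cardinal, and if $Z(x)$ then $qc(x)=_E card(x)$. (Q20) $\forall_Q x(x\neq_E\emptyset\Rightarrow qc(x)\neq_E 0)$. (Q21) for every qset $x$ and cardinal $\beta\le qc(x)$ there is a qset $y\subseteq x$ with $qc(y)=_E\beta$. (Q22) for qsets $y\subseteq x$, $qc(y)\le qc(x)$. (Q23) for qsets, $Fin(x)\wedge x\subset y\Rightarrow qc(x)<qc(y)$. (Q24) for qsets $x,y$ with no common element, $qc(x\cup y)=_E qc(x)+qc(y)$. (Q25) $\forall_Q x(qc(\mathcal{P}(x))=_E 2^{qc(x)})$. For nonempty qsets: $Sim(x,y):=\forall z\forall t(z\in x\wedge t\in y\Rightarrow z\equiv t)$, $QSim(x,y):=Sim(x,y)\wedge qc(x)=_E qc(y)$; $x/{\equiv}$ denotes the qset of the classes $[t\in x: t\equiv s]$ for $s\in x$. (Q26) Weak extensionality: $\forall_Q x\forall_Q y\big((\forall z(z\in x/{\equiv}\Rightarrow\exists t(t\in y/{\equiv}\wedge QSim(z,t)))\wedge\forall t(t\in y/{\equiv}\Rightarrow\exists z(z\in x/{\equiv}\wedge QSim(t,z))))\Rightarrow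 x\equiv y\big)$. (Q27) Replacement: for each formula $A(x,y)$, if $\forall x\exists y A(x,y)\wedge\forall x\forall x'\forall y\forall y'(A(x,y)\wedge A(x',y')\wedge x\equiv x'\Rightarrow y\equiv y')$, then $\forall_Q u\exists_Q v\forall z(z\in v\Rightarrow\exists w(w\in u\wedge A(w,z)))$. (Q28) Choice: $\forall_Q x\big(E(x)\wedge\forall y\forall z(y\in x\wedge z\in x\Rightarrow y\cap z=_E\emptyset\wedge y\neq_E\emptyset)\Rightarrow\exists_Q u\forall y\forall v(y\in x\wedge v\in y\Rightarrow\exists_Q w(w\subseteq[v]\wedge qc(w)=_E1\wedge w\cap y\equiv w\cap u))\big)$. The theory $\mathcal{Q}\#$ is $\mathcal{Q}$ with axiom (Q4) replaced by (Q4#): $\forall x\forall y(\neg m(x)\wedge\neg m(y)\wedge x\equiv y\Rightarrow(A(x,x)\Rightarrow A(x,y)))$, for every formula $A$ with the same substitution conventions as in (Q4). *)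

theory Defs
  imports Main
begin

text \<open>
  The theory Q# is a first-order theory without a primitive equality symbol. A statement
  ``in the theory Q#'' is rendered as truth in every structure (of every type) satisfying the
  axioms, and HOL equality between objects of the domain is never used below. The axiom
  schemes range over the first-order formulas of the language (with arbitrary parameters), not over
  all HOL predicates; these formulas are therefore represented by a datatype.
\<close>

record 'a qstruct =
  matom :: "'a \<Rightarrow> bool"
  Matom :: "'a \<Rightarrow> bool"
  sset :: "'a \<Rightarrow> bool"
  indist :: "'a \<Rightarrow> 'a \<Rightarrow> bool"
  qmem :: "'a \<Rightarrow> 'a \<Rightarrow> bool"
  qc :: "'a \<Rightarrow> 'a"

datatype tm = Var nat | Qc tm

datatype fm =
    FmAtom tm
  | FMAtom tm
  | FSet tm
  | FInd tm tm
  | FMem tm tm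
  | FNeg fm
  | FImp fm fm
  | FAll nat fm

primrec tval :: "'a qstruct \<Rightarrow> (nat \<Rightarrow> 'a) \<Rightarrow> tm \<Rightarrow> 'a" where
  "tval U e (Var i) = e i"
| "tval U e (Qc t) = qc U (tval U e t)"

primrec sat :: "'a qstruct \<Rightarrow> (nat \<Rightarrow> 'a) \<Rightarrow> fm \<Rightarrow> bool" where
  "sat U e (FmAtom t) \<longleftrightarrow> matom U (tval U e t)"
| "sat U e (FMAtom t) \<longleftrightarrow> Matom U (tval U e t)"
| "sat U e (FSet t) \<longleftrightarrow> sset U (tval U e t)"
| "sat U e (FInd s t) \<longleftrightarrow> indist U (tval U e s) (tval U e t)"
| "sat U e (FMem s t) \<longleftrightarrow> qmem U (tval U e s) (tval U e t)"
| "sat U e (FNeg A) \<longleftrightarrow> \<not> sat U e A"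
| "sat U e (FImp A B) \<longleftrightarrow> (sat U e A \<longrightarrow> sat U e B)"
| "sat U e (FAll i A) \<longleftrightarrow> (\<forall>d. sat U (e(i := d)) A)"

text \<open>
  \<open>repl x y A B\<close>: the formula \<open>B\<close> arises from \<open>A\<close> by replacing some (possibly none, possibly all)
  free occurrences of the variable \<open>x\<close> by \<open>y\<close>, none of the new occurrences of \<open>y\<close> being captured.
\<close>

inductive repl_tm :: "nat \<Rightarrow> nat \<Rightarrow> tm \<Rightarrow> tm \<Rightarrow> bool" for x y where
  keep: "repl_tm x y t t"
| var: "repl_tm x y (Var x) (Var y)"
| qc: "repl_tm x y s t \<Longrightarrow> repl_tm x y (Qc s) (Qc t)"

inductive repl :: "nat \<Rightarrow> nat \<Rightarrow> fm \<Rightarrow> fm \<Rightarrow> bool" for x y where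
  keep: "repl x y A A"
| m: "repl_tm x y s t \<Longrightarrow> repl x y (FmAtom s) (FmAtom t)"
| M: "repl_tm x y s t \<Longrightarrow> repl x y (FMAtom s) (FMAtom t)"
| Z: "repl_tm x y s t \<Longrightarrow> repl x y (FSet s) (FSet t)"
| ind: "repl_tm x y s s' \<Longrightarrow> repl_tm x y t t' \<Longrightarrow> repl x y (FInd s t) (FInd s' t')"
| mem: "repl_tm x y s s' \<Longrightarrow> repl_tm x y t t' \<Longrightarrow> repl x y (FMem s t) (FMem s' t')"
| neg: "repl x y A A' \<Longrightarrow> repl x y (FNeg A) (FNeg A')"
| imp: "repl x y A A' \<Longrightarrow> repl x y B B' \<Longrightarrow> repl x y (FImp A B) (FImp A' B')"
| all: "i \<noteq> x \<Longrightarrow> i \<noteq> y \<Longrightarrow> repl x y A A' \<Longrightarrow> repl x y (FAll i A) (FAll i A')"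

text \<open>
  Apart from \<open>qc\<close> the language has no function symbols, so a defined term such as \<open>[x, y]\<close> is given
  by its graph \<open>is_pair x y\<close>; it denotes an object that is unique only up to extensional identity.
\<close>

locale qset_language =
  fixes U :: "'a qstruct"
begin

abbreviation ind (infix "\<approx>" 50) where "x \<approx> y \<equiv> indist U x y"
abbreviation mem (infix "\<in>\<^sub>q" 50) where "x \<in>\<^sub>q y \<equiv> qmem U x y"

definition qset :: "'a \<Rightarrow> bool" where
  "qset x \<longleftrightarrow> \<not> (matom U x \<or> Matom U x)"

definition dobj :: "'a \<Rightarrow> bool" where
  "dobj x \<longleftrightarrow> Matom U x \<or> sset U x"

definition eset :: "'a \<Rightarrow> bool" where
  "eset x \<longleftrightarrow> qset x \<and> (\<forall>y. y \<in>\<^sub>q x \<longrightarrow> qset y)"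

definition exteq :: "'a \<Rightarrow> 'a \<Rightarrow> bool" (infix "=\<^sub>E" 50) where
  "x =\<^sub>E y \<longleftrightarrow>
     (qset x \<and> qset y \<and> (\<forall>z. z \<in>\<^sub>q x \<longleftrightarrow> z \<in>\<^sub>q y)) \<or>
     (Matom U x \<and> Matom U y \<and> (\<forall>z. qset z \<longrightarrow> (x \<in>\<^sub>q z \<longleftrightarrow> y \<in>\<^sub>q z)))"

definition subq :: "'a \<Rightarrow> 'a \<Rightarrow> bool" (infix "\<subseteq>\<^sub>q" 50) where
  "x \<subseteq>\<^sub>q y \<longleftrightarrow> (\<forall>z. z \<in>\<^sub>q x \<longrightarrow> z \<in>\<^sub>q y)"

definition psubq :: "'a \<Rightarrow> 'a \<Rightarrow> bool" (infix "\<subset>\<^sub>q" 50) where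
  "x \<subset>\<^sub>q y \<longleftrightarrow> x \<subseteq>\<^sub>q y \<and> \<not> x =\<^sub>E y"

text \<open>\<open>eq_term w T\<close>: \<open>w\<close> is extensionally identical to the defined term with graph \<open>T\<close>.\<close>

definition eq_term :: "'a \<Rightarrow> ('a \<Rightarrow> bool) \<Rightarrow> bool" where
  "eq_term w T \<longleftrightarrow> (\<exists>z. T z \<and> w =\<^sub>E z)"

definition is_empty :: "'a \<Rightarrow> bool" where
  "is_empty z \<longleftrightarrow> qset z \<and> (\<forall>y. \<not> y \<in>\<^sub>q z)"

definition is_pair :: "'a \<Rightarrow> 'a \<Rightarrow> 'a \<Rightarrow> bool" where
  "is_pair x y z \<longleftrightarrow> qset z \<and> (\<forall>t. t \<in>\<^sub>q z \<longleftrightarrow> t \<approx> x \<or> t \<approx> y)"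

abbreviation is_sing :: "'a \<Rightarrow> 'a \<Rightarrow> bool" where
  "is_sing x \<equiv> is_pair x x"

definition is_opair :: "'a \<Rightarrow> 'a \<Rightarrow> 'a \<Rightarrow> bool" where
  "is_opair x y z \<longleftrightarrow> (\<exists>s p. is_sing x s \<and> is_pair x y p \<and> is_pair s p z)"

definition is_Union :: "'a \<Rightarrow> 'a \<Rightarrow> bool" where
  "is_Union x z \<longleftrightarrow> qset z \<and> (\<forall>s. s \<in>\<^sub>q z \<longleftrightarrow> (\<exists>t. s \<in>\<^sub>q t \<and> t \<in>\<^sub>q x))"

definition is_union :: "'a \<Rightarrow> 'a \<Rightarrow> 'a \<Rightarrow> bool" where
  "is_union x y z \<longleftrightarrow> qset z \<and> (\<forall>t. t \<in>\<^sub>q z \<longleftrightarrow> t \<in>\<^sub>q x \<or> t \<in>\<^sub>q y)"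

definition is_inter :: "'a \<Rightarrow> 'a \<Rightarrow> 'a \<Rightarrow> bool" where
  "is_inter x y z \<longleftrightarrow> qset z \<and> (\<forall>t. t \<in>\<^sub>q z \<longleftrightarrow> t \<in>\<^sub>q x \<and> t \<in>\<^sub>q y)"

text \<open>
  The power qset collects sub-qsets. Without the conjunct \<open>qset t\<close> it would contain every atom,
  atoms being vacuously included in everything, and \<open>qc(P(\<emptyset>)) = 2\<^sup>0\<close> would rule out atoms.
\<close>

definition is_power :: "'a \<Rightarrow> 'a \<Rightarrow> bool" where
  "is_power x z \<longleftrightarrow> qset z \<and> (\<forall>t. t \<in>\<^sub>q z \<longleftrightarrow> qset t \<and> t \<subseteq>\<^sub>q x)"

definition is_class :: "'a \<Rightarrow> 'a \<Rightarrow> 'a \<Rightarrow> bool" where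
  "is_class x s c \<longleftrightarrow> qset c \<and> (\<forall>t. t \<in>\<^sub>q c \<longleftrightarrow> t \<in>\<^sub>q x \<and> t \<approx> s)"

definition is_quot :: "'a \<Rightarrow> 'a \<Rightarrow> bool" where
  "is_quot x z \<longleftrightarrow> qset z \<and> (\<forall>c. c \<in>\<^sub>q z \<longleftrightarrow> (\<exists>s. s \<in>\<^sub>q x \<and> is_class x s c))"

definition Sim :: "'a \<Rightarrow> 'a \<Rightarrow> bool" where
  "Sim x y \<longleftrightarrow> (\<forall>z t. z \<in>\<^sub>q x \<and> t \<in>\<^sub>q y \<longrightarrow> z \<approx> t)"

definition QSim :: "'a \<Rightarrow> 'a \<Rightarrow> bool" where
  "QSim x y \<longleftrightarrow> Sim x y \<and> qc U x =\<^sub>E qc U y"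

text \<open>
  In the copy of ZFU, identity is \<open>=\<^sub>E\<close>; ordinals are von Neumann ordinals and cardinals are
  initial ordinals.
\<close>

definition ordinal :: "'a \<Rightarrow> bool" where
  "ordinal a \<longleftrightarrow>
     sset U a \<and>
     (\<forall>x. x \<in>\<^sub>q a \<longrightarrow> sset U x \<and> x \<subseteq>\<^sub>q a) \<and>
     (\<forall>x y. x \<in>\<^sub>q a \<and> y \<in>\<^sub>q a \<longrightarrow> x \<in>\<^sub>q y \<or> x =\<^sub>E y \<or> y \<in>\<^sub>q x) \<and>
     (\<forall>s. sset U s \<and> s \<subseteq>\<^sub>q a \<and> \<not> is_empty s \<longrightarrow>
          (\<exists>l. l \<in>\<^sub>q s \<and> (\<forall>t. t \<in>\<^sub>q s \<longrightarrow> \<not> t \<in>\<^sub>q l)))"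

definition is_succ :: "'a \<Rightarrow> 'a \<Rightarrow> bool" where
  "is_succ a b \<longleftrightarrow> sset U b \<and> (\<forall>t. t \<in>\<^sub>q b \<longleftrightarrow> t \<in>\<^sub>q a \<or> t =\<^sub>E a)"

abbreviation is_zero :: "'a \<Rightarrow> bool" where
  "is_zero \<equiv> is_empty"

definition is_one :: "'a \<Rightarrow> bool" where
  "is_one b \<longleftrightarrow> (\<exists>a. is_zero a \<and> is_succ a b)"

definition is_two :: "'a \<Rightarrow> bool" where
  "is_two b \<longleftrightarrow> (\<exists>a. is_one a \<and> is_succ a b)"

definition natnum :: "'a \<Rightarrow> bool" where
  "natnum n \<longleftrightarrow> ordinal n \<and>
     (\<forall>k. k \<in>\<^sub>q n \<or> k =\<^sub>E n \<longrightarrow> is_zero k \<or> (\<exists>j. ordinal j \<and> is_succ j k))"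

definition opair_mem :: "'a \<Rightarrow> 'a \<Rightarrow> 'a \<Rightarrow> bool" where
  "opair_mem u v f \<longleftrightarrow> (\<exists>p. is_opair u v p \<and> p \<in>\<^sub>q f)"

definition is_fun :: "'a \<Rightarrow> 'a \<Rightarrow> 'a \<Rightarrow> bool" where
  "is_fun f a b \<longleftrightarrow>
     sset U f \<and>
     (\<forall>p. p \<in>\<^sub>q f \<longrightarrow> (\<exists>u v. u \<in>\<^sub>q a \<and> v \<in>\<^sub>q b \<and> is_opair u v p)) \<and>
     (\<forall>u. u \<in>\<^sub>q a \<longrightarrow> (\<exists>v. v \<in>\<^sub>q b \<and> opair_mem u v f)) \<and>
     (\<forall>u v w. opair_mem u v f \<and> opair_mem u w f \<longrightarrow> v =\<^sub>E w)"

definition is_bij :: "'a \<Rightarrow> 'a \<Rightarrow> 'a \<Rightarrow> bool" where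
  "is_bij f a b \<longleftrightarrow>
     is_fun f a b \<and>
     (\<forall>u w v. opair_mem u v f \<and> opair_mem w v f \<longrightarrow> u =\<^sub>E w) \<and>
     (\<forall>v. v \<in>\<^sub>q b \<longrightarrow> (\<exists>u. u \<in>\<^sub>q a \<and> opair_mem u v f))"

definition equinum :: "'a \<Rightarrow> 'a \<Rightarrow> bool" where
  "equinum a b \<longleftrightarrow> (\<exists>f. is_bij f a b)"

definition cardinal :: "'a \<Rightarrow> bool" where
  "cardinal k \<longleftrightarrow> ordinal k \<and> (\<forall>a. a \<in>\<^sub>q k \<longrightarrow> \<not> equinum a k)"

definition is_card :: "'a \<Rightarrow> 'a \<Rightarrow> bool" where
  "is_card x k \<longleftrightarrow> cardinal k \<and> equinum x k"

definition card_less :: "'a \<Rightarrow> 'a \<Rightarrow> bool" where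
  "card_less k l \<longleftrightarrow> k \<in>\<^sub>q l"

definition card_le :: "'a \<Rightarrow> 'a \<Rightarrow> bool" where
  "card_le k l \<longleftrightarrow> card_less k l \<or> k =\<^sub>E l"

definition is_card_sum :: "'a \<Rightarrow> 'a \<Rightarrow> 'a \<Rightarrow> bool" where
  "is_card_sum k l n \<longleftrightarrow>
     (\<exists>a b c. sset U a \<and> sset U b \<and> equinum a k \<and> equinum b l \<and>
        \<not> (\<exists>t. t \<in>\<^sub>q a \<and> t \<in>\<^sub>q b) \<and> is_union a b c \<and> is_card c n)"

text \<open>\<open>2\<^sup>k\<close> is the cardinal of the set of all functions from \<open>k\<close> to \<open>2\<close>.\<close>

definition is_two_power :: "'a \<Rightarrow> 'a \<Rightarrow> bool" where
  "is_two_power k n \<longleftrightarrow>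
     (\<exists>d F. is_two d \<and> sset U F \<and> (\<forall>f. f \<in>\<^sub>q F \<longleftrightarrow> is_fun f k d) \<and> is_card F n)"

definition Fin :: "'a \<Rightarrow> bool" where
  "Fin x \<longleftrightarrow> natnum (qc U x)"

end

text \<open>
  In the schemes the environment \<open>e\<close> supplies the parameters. In Separation the qset being
  asserted to exist is not a value available to \<open>e\<close>, which is the proviso that its variable
  is not free in the formula.
\<close>

locale Qsharp = qset_language U for U :: "'a qstruct" +
  assumes Q1: "\<forall>x. x \<approx> x"
    and Q2: "\<forall>x y. x \<approx> y \<longrightarrow> y \<approx> x"
    and Q3: "\<forall>x y z. x \<approx> y \<and> y \<approx> z \<longrightarrow> x \<approx> z"
    and Q4sharp: "\<forall>A A' x y e. repl x y A A' \<longrightarrow>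
      \<not> matom U (e x) \<and> \<not> matom U (e y) \<and> e x \<approx> e y \<longrightarrow> (sat U e A \<longrightarrow> sat U e A')"
    and Q5: "\<forall>x. \<not> (matom U x \<and> Matom U x)"
    and Q6: "\<forall>x y. x \<in>\<^sub>q y \<longrightarrow> qset y"
    and Q7: "\<forall>x. sset U x \<longrightarrow> qset x"
    and Q8: "\<forall>x. qset x \<longrightarrow> ((\<forall>y. y \<in>\<^sub>q x \<longrightarrow> dobj y) \<longleftrightarrow> sset U x)"
    and Q9_m: "\<forall>x y. matom U x \<and> x \<approx> y \<longrightarrow> matom U y"
    and Q9_M: "\<forall>x y. x =\<^sub>E y \<and> Matom U x \<longrightarrow> Matom U y"
    and Q9_Z: "\<forall>x y. x =\<^sub>E y \<and> sset U x \<longrightarrow> sset U y"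
    and Q10: "\<exists>x. qset x \<and> (\<forall>y. \<not> y \<in>\<^sub>q x)"
    and Q11: "\<forall>x y. dobj x \<and> dobj y \<longrightarrow> (x \<approx> y \<longrightarrow> x =\<^sub>E y)"
    and Q12: "\<forall>x y. \<exists>z. is_pair x y z"
    and Q13: "\<forall>A e i x. qset x \<longrightarrow>
      (\<exists>y. qset y \<and> (\<forall>t. t \<in>\<^sub>q y \<longleftrightarrow> t \<in>\<^sub>q x \<and> sat U (e(i := t)) A))"
    and Q14: "\<forall>x. qset x \<longrightarrow> (eset x \<longrightarrow> (\<exists>y. is_Union x y))"
    and Q15: "\<forall>x. qset x \<longrightarrow> (\<exists>y. is_power x y)"
    and Q16: "\<exists>x. qset x \<and> (\<exists>z. is_empty z \<and> z \<in>\<^sub>q x) \<and>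
      (\<forall>y. y \<in>\<^sub>q x \<and> qset y \<longrightarrow> (\<exists>s u. is_sing y s \<and> is_union y s u \<and> u \<in>\<^sub>q x))"
    and Q17: "\<forall>x. qset x \<longrightarrow> (eset x \<and> \<not> eq_term x is_empty \<longrightarrow>
      (\<exists>y. qset y \<and> y \<in>\<^sub>q x \<and> (\<exists>i. is_inter y x i \<and> eq_term i is_empty)))"
    and Q18: "\<forall>x. \<not> qset x \<longrightarrow> eq_term (qc U x) is_zero"
    and Q19: "\<forall>x. qset x \<longrightarrow> cardinal (qc U x) \<and> (sset U x \<longrightarrow> eq_term (qc U x) (is_card x))"
    and Q20: "\<forall>x. qset x \<longrightarrow> (\<not> eq_term x is_empty \<longrightarrow> \<not> eq_term (qc U x) is_zero)"
    and Q21: "\<forall>x b. qset x \<and> cardinal b \<and> card_le b (qc U x) \<longrightarrow>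
      (\<exists>y. qset y \<and> y \<subseteq>\<^sub>q x \<and> qc U y =\<^sub>E b)"
    and Q22: "\<forall>x y. qset x \<and> qset y \<and> y \<subseteq>\<^sub>q x \<longrightarrow> card_le (qc U y) (qc U x)"
    and Q23: "\<forall>x y. qset x \<and> qset y \<longrightarrow> (Fin x \<and> x \<subset>\<^sub>q y \<longrightarrow> card_less (qc U x) (qc U y))"
    and Q24: "\<forall>x y. qset x \<and> qset y \<and> \<not> (\<exists>t. t \<in>\<^sub>q x \<and> t \<in>\<^sub>q y) \<longrightarrow>
      (\<exists>u. is_union x y u \<and> eq_term (qc U u) (is_card_sum (qc U x) (qc U y)))"
    and Q25: "\<forall>x. qset x \<longrightarrow>
      (\<exists>p. is_power x p \<and> eq_term (qc U p) (is_two_power (qc U x)))"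
    and Q26: "\<forall>x y X Y. qset x \<and> qset y \<and> is_quot x X \<and> is_quot y Y \<longrightarrow>
      ((\<forall>z. z \<in>\<^sub>q X \<longrightarrow> (\<exists>t. t \<in>\<^sub>q Y \<and> QSim z t)) \<and>
       (\<forall>t. t \<in>\<^sub>q Y \<longrightarrow> (\<exists>z. z \<in>\<^sub>q X \<and> QSim t z)) \<longrightarrow> x \<approx> y)"
    and Q27: "\<forall>A e i j. i \<noteq> j \<longrightarrow>
      (\<forall>x. \<exists>y. sat U (e(i := x, j := y)) A) \<and>
      (\<forall>x x' y y'. sat U (e(i := x, j := y)) A \<and> sat U (e(i := x', j := y')) A \<and> x \<approx> x'
         \<longrightarrow> y \<approx> y') \<longrightarrow>
      (\<forall>u. qset u \<longrightarrow> (\<exists>v. qset v \<and>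
         (\<forall>z. z \<in>\<^sub>q v \<longrightarrow> (\<exists>w. w \<in>\<^sub>q u \<and> sat U (e(i := w, j := z)) A))))"
    and Q28: "\<forall>x. qset x \<longrightarrow>
      (eset x \<and>
       (\<forall>y z. y \<in>\<^sub>q x \<and> z \<in>\<^sub>q x \<longrightarrow>
          (\<exists>i. is_inter y z i \<and> eq_term i is_empty) \<and> \<not> eq_term y is_empty) \<longrightarrow>
       (\<exists>u. qset u \<and> (\<forall>y v. y \<in>\<^sub>q x \<and> v \<in>\<^sub>q y \<longrightarrow>
          (\<exists>w. qset w \<and> (\<exists>s. is_sing v s \<and> w \<subseteq>\<^sub>q s) \<and> eq_term (qc U w) is_one \<and>
             (\<exists>a b. is_inter w y a \<and> is_inter w u b \<and> a \<approx> b)))))"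

end

(*
  By weak extensionality and (Q4#), two nonempty sub-qsets of [x] with the same quasi-cardinal
  are indistinguishable and hence have the same elements. Since [x] is nonempty, it has a
  sub-qset y with qc(y) = 1. If [x] - y were nonempty, it would contain another sub-qset of
  quasi-cardinal 1, which would have the same elements as y but be disjoint from it. So
  [x] and y are extensionally identical.
*)

theory Submission
  imports Defs
begin

context Qsharp
begin

section \<open>Indistinguishability and substitution of qsets\<close>

lemma ind_refl: "x \<approx> x"
  using Q1 by blast

lemma ind_sym: "x \<approx> y \<Longrightarrow> y \<approx> x"
  using Q2 by blast

lemma ind_trans: "x \<approx> y \<Longrightarrow> y \<approx> z \<Longrightarrow> x \<approx> z"
  using Q3 by blast

lemma qset_not_matom: "qset x \<Longrightarrow> \<not> matom U x"
  by (simp add: qset_def)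

lemma sset_qset: "sset U x \<Longrightarrow> qset x"
  using Q7 by blast

lemma exteq_iff_qset:
  assumes "qset x" "qset y"
  shows "x =\<^sub>E y \<longleftrightarrow> (\<forall>z. z \<in>\<^sub>q x \<longleftrightarrow> z \<in>\<^sub>q y)"
  using assms by (auto simp: exteq_def qset_def)

lemma subst_mem_left:
  assumes "qset x" "qset y" "x \<approx> y" "x \<in>\<^sub>q z"
  shows "y \<in>\<^sub>q z"
proof -
  have "repl 0 1 (FMem (Var 0) (Var 2)) (FMem (Var 1) (Var 2))"
    by (intro repl.mem repl_tm.var repl_tm.keep)
  \<comment> \<open>Variables 0 and 1 stand for \<open>x\<close> and \<open>y\<close>; the parameter
    \<open>z\<close> is the default value of the environment and is read at variable 2.\<close>
  from Q4sharp[rule_format, OF this, of "(\<lambda>_. z)(0 := x, 1 := y)"] assms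
  show ?thesis by (simp add: qset_not_matom)
qed

lemma subst_mem_right:
  assumes "qset x" "qset y" "x \<approx> y" "z \<in>\<^sub>q x"
  shows "z \<in>\<^sub>q y"
proof -
  have "repl 0 1 (FMem (Var 2) (Var 0)) (FMem (Var 2) (Var 1))"
    by (intro repl.mem repl_tm.var repl_tm.keep)
  from Q4sharp[rule_format, OF this, of "(\<lambda>_. z)(0 := x, 1 := y)"] assms
  show ?thesis by (simp add: qset_not_matom)
qed

section \<open>Quasi-cardinals as sets\<close>

lemma qc_cardinal: "qset x \<Longrightarrow> cardinal (qc U x)"
  using Q19 by blast

lemma cardinal_sset: "cardinal k \<Longrightarrow> sset U k"
  by (simp add: cardinal_def ordinal_def)

lemma cardinal_qset: "cardinal k \<Longrightarrow> qset k"
  by (simp add: cardinal_sset sset_qset)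

lemma qc_qset: "qset x \<Longrightarrow> qset (qc U x)"
  by (simp add: qc_cardinal cardinal_qset)

text \<open>(Q4#) replaces only the second \<open>x\<close> in
  \<open>qc U x \<approx> qc U x\<close>. Quasi-cardinals of qsets are sets, so (Q11) turns the
  resulting indistinguishability into extensional identity.\<close>

lemma qc_cong:
  assumes "qset x" "qset y" "x \<approx> y"
  shows "qc U x =\<^sub>E qc U y"
proof -
  have "repl 0 1 (FInd (Qc (Var 0)) (Qc (Var 0))) (FInd (Qc (Var 0)) (Qc (Var 1)))"
    by (intro repl.ind repl_tm.qc repl_tm.var repl_tm.keep)
  from Q4sharp[rule_format, OF this, of "(\<lambda>_. x)(0 := x, 1 := y)"] assms
  have "qc U x \<approx> qc U y" by (simp add: qset_not_matom ind_refl)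
  moreover have "dobj (qc U x)" "dobj (qc U y)"
    using assms by (auto simp: dobj_def intro: cardinal_sset qc_cardinal)
  ultimately show ?thesis using Q11 by blast
qed

section \<open>Quotients and weak extensionality\<close>

lemma quot_exists:
  assumes "qset x"
  shows "\<exists>X. is_quot x X"
proof -
  obtain p where p: "is_power x p" using Q15 assms by blast
  then have "qset p" by (simp add: is_power_def)
  \<comment> \<open>The quotient is separated from the power qset. Variable 0 is the candidate
    class, 1 is \<open>x\<close>, 2 the representative, 3 a test element. \<open>?B\<close> encodes
    a conjunction of two implications; that a class is included in \<open>x\<close> comes from its
    membership in \<open>p\<close>.\<close>
  let ?B = "FAll 3 (FNeg (FImp (FImp (FMem (Var 3) (Var 0)) (FInd (Var 3) (Var 2)))
    (FNeg (FImp (FMem (Var 3) (Var 1)) (FImp (FInd (Var 3) (Var 2)) (FMem (Var 3) (Var 0)))))))"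
  let ?A = "FNeg (FAll 2 (FImp (FMem (Var 2) (Var 1)) (FNeg ?B)))"
  from Q13[rule_format, OF \<open>qset p\<close>, of "(\<lambda>_. x)" 0 ?A]
  obtain X where X: "qset X" "\<And>c. c \<in>\<^sub>q X \<longleftrightarrow> c \<in>\<^sub>q p \<and>
      (\<exists>s. s \<in>\<^sub>q x \<and> (\<forall>t. (t \<in>\<^sub>q c \<longrightarrow> t \<approx> s) \<and> (t \<in>\<^sub>q x \<longrightarrow> t \<approx> s \<longrightarrow> t \<in>\<^sub>q c)))"
    by auto
  have "is_quot x X"
    unfolding is_quot_def is_class_def
    using X p by (auto simp: is_power_def subq_def; blast)
  then show ?thesis ..
qed

text \<open>Weak extensionality with the quotients eliminated, so that classes can be matched
  directly.\<close>

lemma indI: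
  assumes "qset x" "qset y"
    and "\<And>s c. \<lbrakk>s \<in>\<^sub>q x; is_class x s c\<rbrakk> \<Longrightarrow> \<exists>t d. t \<in>\<^sub>q y \<and> is_class y t d \<and> QSim c d"
    and "\<And>t d. \<lbrakk>t \<in>\<^sub>q y; is_class y t d\<rbrakk> \<Longrightarrow> \<exists>s c. s \<in>\<^sub>q x \<and> is_class x s c \<and> QSim d c"
  shows "x \<approx> y"
proof -
  obtain X where X: "is_quot x X" using quot_exists assms(1) by blast
  obtain Y where Y: "is_quot y Y" using quot_exists assms(2) by blast
  have mem: "c \<in>\<^sub>q X \<longleftrightarrow> (\<exists>s. s \<in>\<^sub>q x \<and> is_class x s c)"
    "c \<in>\<^sub>q Y \<longleftrightarrow> (\<exists>s. s \<in>\<^sub>q y \<and> is_class y s c)" for c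
    using X Y by (simp_all add: is_quot_def)
  have "\<exists>d. d \<in>\<^sub>q Y \<and> QSim c d" if "c \<in>\<^sub>q X" for c
    using that assms(3) unfolding mem by blast
  moreover have "\<exists>c. c \<in>\<^sub>q X \<and> QSim d c" if "d \<in>\<^sub>q Y" for d
    using that assms(4) unfolding mem by blast
  ultimately show ?thesis
    using Q26 X Y assms(1,2) by simp
qed

text \<open>Qsets with the same elements have the same classes, and each class is matched with
  itself. Since (Q4#) substitutes only indistinguishable objects, this is what permits replacing
  extensionally identical qsets.\<close>

lemma exteq_imp_ind:
  assumes "qset x" "qset y" "x =\<^sub>E y"
  shows "x \<approx> y"
proof -
  have eq: "z \<in>\<^sub>q x \<longleftrightarrow> z \<in>\<^sub>q y" for z
    using assms exteq_iff_qset by blast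
  then have cl: "is_class x s c \<longleftrightarrow> is_class y s c" for s c
    by (simp add: is_class_def)
  have qsim: "QSim c c" if c: "is_class x s c" for s c
  proof -
    have "z \<approx> t" if "z \<in>\<^sub>q c" "t \<in>\<^sub>q c" for z t
    proof -
      have "z \<approx> s" "t \<approx> s" using that c by (simp_all add: is_class_def)
      then show ?thesis by (meson ind_sym ind_trans)
    qed
    moreover have "qset (qc U c)" using c qc_qset by (simp add: is_class_def)
    ultimately show ?thesis by (simp add: QSim_def Sim_def exteq_iff_qset)
  qed
  show ?thesis
  proof (rule indI[OF assms(1,2)])
    show "\<exists>t d. t \<in>\<^sub>q y \<and> is_class y t d \<and> QSim c d" if "s \<in>\<^sub>q x" "is_class x s c" for s c
      using that eq cl qsim by blast
    show "\<exists>s c. s \<in>\<^sub>q x \<and> is_class x s c \<and> QSim d c" if "t \<in>\<^sub>q y" "is_class y t d" for t d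
      using that eq cl qsim by blast
  qed
qed

text \<open>All elements of \<open>y\<close> and \<open>z\<close> are indistinguishable from one
  another, so each qset is, up to extensional identity, its own only class, and weak extensionality
  compares nothing but the two quasi-cardinals.\<close>

lemma Sim_imp_ind:
  assumes "qset y" "qset z"
    and "\<exists>t. t \<in>\<^sub>q y" "\<exists>t. t \<in>\<^sub>q z"
    and "Sim y z" "qc U y =\<^sub>E qc U z"
  shows "y \<approx> z"
proof -
  \<comment> \<open>Two elements of \<open>y\<close> are compared through \<open>v\<close>, two
    elements of \<open>z\<close> through \<open>u\<close>.\<close>
  obtain u v where uv: "u \<in>\<^sub>q y" "v \<in>\<^sub>q z" using assms by blast
  have yz: "s \<approx> t" "t \<approx> s" if "s \<in>\<^sub>q y" "t \<in>\<^sub>q z" for s t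
    using that \<open>Sim y z\<close> ind_sym unfolding Sim_def by blast+
  have yy: "s \<approx> t" if "s \<in>\<^sub>q y" "t \<in>\<^sub>q y" for s t
    using that yz uv(2) ind_trans by blast
  have zz: "s \<approx> t" if "s \<in>\<^sub>q z" "t \<in>\<^sub>q z" for s t
    using that yz uv(1) ind_trans by blast
  have qc_class: "qc U c =\<^sub>E qc U w"
    if w: "qset w" and ww: "\<And>s t. s \<in>\<^sub>q w \<Longrightarrow> t \<in>\<^sub>q w \<Longrightarrow> s \<approx> t"
      and c: "s \<in>\<^sub>q w" "is_class w s c" for w s c
  proof -
    have "qset c" "c =\<^sub>E w"
      using w ww c by (auto simp: is_class_def exteq_iff_qset)
    then show ?thesis using exteq_imp_ind qc_cong w by blast
  qed
  have qsim: "QSim c d" "QSim d c"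
    if c: "s \<in>\<^sub>q y" "is_class y s c" and d: "t \<in>\<^sub>q z" "is_class z t d" for s t c d
  proof -
    have qs: "qset c" "qset d" using c d by (auto simp: is_class_def)
    have "qc U c =\<^sub>E qc U d"
      using qc_class[OF assms(1) yy c] qc_class[OF assms(2) zz d] assms qs qc_qset
      by (simp add: exteq_iff_qset)
    moreover from this have "qc U d =\<^sub>E qc U c"
      using qs qc_qset by (simp add: exteq_iff_qset)
    ultimately show "QSim c d" "QSim d c"
      using c d yz by (auto simp: QSim_def Sim_def is_class_def)
  qed
  have self: "is_class y u y" "is_class z v z"
    using assms uv yy zz by (auto simp: is_class_def)
  show ?thesis
  proof (rule indI[OF assms(1,2)])
    show "\<exists>t d. t \<in>\<^sub>q z \<and> is_class z t d \<and> QSim c d" if "s \<in>\<^sub>q y" "is_class y s c" for s c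
      using qsim(1)[OF that uv(2) self(2)] uv(2) self(2) by blast
    show "\<exists>s c. s \<in>\<^sub>q y \<and> is_class y s c \<and> QSim d c" if "t \<in>\<^sub>q z" "is_class z t d" for t d
      using qsim(2)[OF uv(1) self(1) that] uv(1) self(1) by blast
  qed
qed

section \<open>The empty qset, the number one and its place among the ordinals\<close>

lemma empty_sset: "is_empty z \<Longrightarrow> sset U z"
  using Q8 unfolding is_empty_def by blast

lemma mem_dobj: "sset U s \<Longrightarrow> t \<in>\<^sub>q s \<Longrightarrow> dobj t"
  using Q8 sset_qset by blast

lemma empty_mem:
  assumes "is_empty z" "is_empty t" "z \<in>\<^sub>q x"
  shows "t \<in>\<^sub>q x"
proof -
  have "qset z" "qset t" "z =\<^sub>E t"
    using assms by (auto simp: is_empty_def exteq_def)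
  then show ?thesis using assms exteq_imp_ind subst_mem_left by blast
qed

lemma not_eq_term_empty:
  assumes "qset x"
  shows "\<not> eq_term x is_empty \<longleftrightarrow> (\<exists>y. y \<in>\<^sub>q x)"
proof -
  obtain z where "is_empty z" using Q10 unfolding is_empty_def by blast
  then show ?thesis
    using assms unfolding eq_term_def is_empty_def exteq_def qset_def by blast
qed

text \<open>The power qset of an empty qset serves as 1. Empty qsets are unique only up to
  \<open>=\<^sub>E\<close>, so its elements are all the empty qsets.\<close>

lemma one_exists: "\<exists>b. sset U b \<and> is_one b \<and> (\<forall>t. t \<in>\<^sub>q b \<longleftrightarrow> is_empty t)"
proof -
  obtain z where z: "is_empty z" using Q10 unfolding is_empty_def by blast
  then have "qset z" by (simp add: is_empty_def)
  then obtain b where "is_power z b" using Q15 by blast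
  then have b: "qset b" "\<And>t. t \<in>\<^sub>q b \<longleftrightarrow> is_empty t"
    using z by (auto simp: is_power_def is_empty_def subq_def)
  then have "sset U b" using Q8 empty_sset unfolding dobj_def by blast
  moreover have "t \<in>\<^sub>q z \<or> t =\<^sub>E z \<longleftrightarrow> is_empty t" for t
    using z by (auto simp: is_empty_def exteq_def qset_def)
  ultimately have "is_succ z b" using b by (simp add: is_succ_def)
  with z \<open>sset U b\<close> b show ?thesis unfolding is_one_def by blast
qed

lemma not_equinum_empty:
  assumes "is_empty a" "t \<in>\<^sub>q k"
  shows "\<not> equinum a k"
  using assms unfolding equinum_def is_bij_def is_empty_def by blast

lemma one_cardinal:
  assumes "sset U b" "\<forall>t. t \<in>\<^sub>q b \<longleftrightarrow> is_empty t"
  shows "cardinal b"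
proof -
  have "ordinal b"
    unfolding ordinal_def
  proof (intro conjI allI impI)
    fix s assume "sset U s \<and> s \<subseteq>\<^sub>q b \<and> \<not> is_empty s"
    then show "\<exists>l. l \<in>\<^sub>q s \<and> (\<forall>t. t \<in>\<^sub>q s \<longrightarrow> \<not> t \<in>\<^sub>q l)"
      using assms sset_qset unfolding is_empty_def subq_def by meson
  next
    fix x y assume "x \<in>\<^sub>q b \<and> y \<in>\<^sub>q b"
    then show "x \<in>\<^sub>q y \<or> x =\<^sub>E y \<or> y \<in>\<^sub>q x"
      using assms unfolding is_empty_def exteq_def by blast
  qed (use assms empty_sset in \<open>auto simp: is_empty_def subq_def\<close>)
  then show ?thesis
    using assms not_equinum_empty unfolding cardinal_def by blast
qed

text \<open>Well-foundedness of ordinals is stated for sets; by (Q8) every sub-qset of a set is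
  itself a set.\<close>

lemma ordinal_least:
  assumes "ordinal k" "qset s" "s \<subseteq>\<^sub>q k" "\<exists>t. t \<in>\<^sub>q s"
  shows "\<exists>l. l \<in>\<^sub>q s \<and> (\<forall>t. t \<in>\<^sub>q s \<longrightarrow> \<not> t \<in>\<^sub>q l)"
proof -
  have "sset U k" using assms(1) by (simp add: ordinal_def)
  then have "sset U s" using assms Q8 mem_dobj unfolding subq_def by blast
  then show ?thesis using assms unfolding ordinal_def is_empty_def by blast
qed

text \<open>Either all elements of \<open>k\<close> are empty and \<open>k\<close> is 1, or a
  minimal nonempty element of \<open>k\<close> has only empty elements, hence is 1, and 1 lies in
  \<open>k\<close>.\<close>

lemma one_le_ordinal:
  assumes b: "sset U b" "\<forall>t. t \<in>\<^sub>q b \<longleftrightarrow> is_empty t"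
    and k: "ordinal k" "\<exists>t. t \<in>\<^sub>q k"
  shows "card_le b k"
proof -
  have qb: "qset b" and qk: "qset k"
    using b k sset_qset by (auto simp: ordinal_def)
  \<comment> \<open>A minimal element of \<open>m\<close> is empty, because by transitivity its
    elements would again lie in \<open>m\<close>.\<close>
  have zero_mem: "z \<in>\<^sub>q m" if m: "ordinal m" "\<exists>t. t \<in>\<^sub>q m" and z: "is_empty z" for m z
  proof -
    have "qset m" using m sset_qset by (simp add: ordinal_def)
    then obtain l where "l \<in>\<^sub>q m" "\<forall>t. t \<in>\<^sub>q m \<longrightarrow> \<not> t \<in>\<^sub>q l"
      using m ordinal_least[of m m] unfolding subq_def by blast
    moreover from this have "is_empty l"
      using m sset_qset unfolding ordinal_def is_empty_def subq_def by blast
    ultimately show ?thesis using z empty_mem by blast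
  qed
  show ?thesis
  proof (cases "\<exists>m. m \<in>\<^sub>q k \<and> \<not> is_empty m")
    case False
    then have "t \<in>\<^sub>q b \<longleftrightarrow> t \<in>\<^sub>q k" for t
      using b(2) zero_mem[OF k] by blast
    then have "b =\<^sub>E k" using qb qk by (simp add: exteq_iff_qset)
    then show ?thesis by (simp add: card_le_def)
  next
    case True
    \<comment> \<open>The formula isolates the nonempty elements of \<open>k\<close>.\<close>
    from Q13[rule_format, OF qk, of "\<lambda>_. k" 0 "FNeg (FAll 1 (FNeg (FMem (Var 1) (Var 0))))"]
    obtain s where s: "qset s" "\<And>t. t \<in>\<^sub>q s \<longleftrightarrow> t \<in>\<^sub>q k \<and> (\<exists>u. u \<in>\<^sub>q t)"
      by auto
    have sset_k: "sset U m" "m \<subseteq>\<^sub>q k" if "m \<in>\<^sub>q k" for m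
      using that k by (auto simp: ordinal_def)
    have "\<exists>t. t \<in>\<^sub>q s"
      using True s sset_k sset_qset unfolding is_empty_def by blast
    then obtain m where m: "m \<in>\<^sub>q s" "\<forall>t. t \<in>\<^sub>q s \<longrightarrow> \<not> t \<in>\<^sub>q m"
      using ordinal_least[of k s] k s unfolding subq_def by blast
    then have mk: "m \<in>\<^sub>q k" and qm: "qset m" using s sset_k sset_qset by auto
    have "is_empty t" if t: "t \<in>\<^sub>q m" for t
    proof -
      have "t \<in>\<^sub>q k" using t sset_k(2)[OF mk] by (simp add: subq_def)
      moreover have "\<not> t \<in>\<^sub>q s" using t m(2) by blast
      ultimately show ?thesis using s(2) sset_k(1) sset_qset by (auto simp: is_empty_def)
    qed
    moreover obtain u where "u \<in>\<^sub>q m" using m(1) s(2) by blast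
    ultimately have "t \<in>\<^sub>q m \<longleftrightarrow> t \<in>\<^sub>q b" for t
      using b(2) empty_mem by blast
    then have "m =\<^sub>E b" using qb qm by (simp add: exteq_iff_qset)
    then have "b \<in>\<^sub>q k"
      using mk qm qb exteq_imp_ind subst_mem_left by blast
    then show ?thesis by (simp add: card_le_def card_less_def)
  qed
qed

section \<open>Sub-qsets of quasi-cardinal one and the singleton\<close>

lemma subq_qc_one:
  assumes b: "sset U b" "\<forall>t. t \<in>\<^sub>q b \<longleftrightarrow> is_empty t"
    and s: "qset s" "\<exists>t. t \<in>\<^sub>q s"
  shows "\<exists>y. qset y \<and> y \<subseteq>\<^sub>q s \<and> qc U y =\<^sub>E b \<and> (\<exists>t. t \<in>\<^sub>q y)"
proof -
  \<comment> \<open>(Q20) makes the quasi-cardinal of \<open>s\<close> a nonempty ordinal, so it is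
    at least 1 and (Q21) applies.\<close>
  have "\<exists>t. t \<in>\<^sub>q qc U s"
    using s Q20 not_eq_term_empty qc_qset by blast
  moreover have "ordinal (qc U s)"
    using s qc_cardinal by (simp add: cardinal_def)
  ultimately obtain y where y: "qset y" "y \<subseteq>\<^sub>q s" "qc U y =\<^sub>E b"
    using Q21 s one_le_ordinal[OF b] one_cardinal[OF b] by blast
  have "\<exists>t. t \<in>\<^sub>q y"
  \<comment> \<open>An empty \<open>y\<close> would be a set, so its quasi-cardinal would be its
    usual cardinal; but an empty set is not equinumerous with the nonempty \<open>b\<close>.\<close>
  proof (rule ccontr)
    assume "\<not> ?thesis"
    then have e: "is_empty y" using y by (simp add: is_empty_def)
    then have "eq_term (qc U y) (is_card y)" using y Q19 empty_sset by blast
    then obtain k where k: "is_card y k" "qc U y =\<^sub>E k" unfolding eq_term_def by blast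
    then have "qset k" using cardinal_qset by (simp add: is_card_def)
    then have "t \<in>\<^sub>q k \<longleftrightarrow> is_empty t" for t
      using k y qc_qset b sset_qset by (simp add: exteq_iff_qset)
    then have "\<not> equinum y k" using e not_equinum_empty by blast
    then show False using k by (simp add: is_card_def)
  qed
  with y show ?thesis by blast
qed

lemma qc_sing:
  assumes s: "is_sing x s"
  shows "eq_term (qc U s) is_one"
proof -
  obtain b where b: "sset U b" "is_one b" "\<forall>t. t \<in>\<^sub>q b \<longleftrightarrow> is_empty t"
    using one_exists by blast
  then have qb: "qset b" using sset_qset by blast
  have qs: "qset s" and mem_s: "\<And>t. t \<in>\<^sub>q s \<longleftrightarrow> t \<approx> x"
    using s by (auto simp: is_pair_def)
  then have "\<exists>t. t \<in>\<^sub>q s" using ind_refl by blast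
  then obtain y where y: "qset y" "y \<subseteq>\<^sub>q s" "qc U y =\<^sub>E b" "\<exists>t. t \<in>\<^sub>q y"
    using subq_qc_one b qs by blast
  have "w \<in>\<^sub>q y" if w: "w \<in>\<^sub>q s" for w
  proof (rule ccontr)
    assume "\<not> w \<in>\<^sub>q y"
    \<comment> \<open>\<open>r\<close> is \<open>[x] - y\<close>; the default value \<open>y\<close>
      of the environment is the parameter at variable 1.\<close>
    from Q13[rule_format, OF qs, of "\<lambda>_. y" 0 "FNeg (FMem (Var 0) (Var 1))"]
    obtain r where r: "qset r" "\<And>t. t \<in>\<^sub>q r \<longleftrightarrow> t \<in>\<^sub>q s \<and> \<not> t \<in>\<^sub>q y"
      by auto
    then have "\<exists>t. t \<in>\<^sub>q r" using w \<open>\<not> w \<in>\<^sub>q y\<close> by blast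
    then obtain y' where y': "qset y'" "y' \<subseteq>\<^sub>q r" "qc U y' =\<^sub>E b" "\<exists>t. t \<in>\<^sub>q y'"
      using subq_qc_one b r by blast
    have "Sim y y'"
      unfolding Sim_def
    proof (intro allI impI)
      fix z t assume "z \<in>\<^sub>q y \<and> t \<in>\<^sub>q y'"
      then have "z \<approx> x" "t \<approx> x" using y(2) y'(2) r(2) mem_s by (auto simp: subq_def)
      then show "z \<approx> t" by (meson ind_sym ind_trans)
    qed
    moreover have "qc U y =\<^sub>E qc U y'"
      using y y' qb qc_qset by (simp add: exteq_iff_qset)
    ultimately have "y \<approx> y'" using Sim_imp_ind y y' by blast
    moreover obtain t where "t \<in>\<^sub>q y" using y(4) by blast
    \<comment> \<open>Here (Q4#) turns indistinguishability of the qsets \<open>y\<close> and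
      \<open>y'\<close> into shared elements, although \<open>y'\<close> was chosen disjoint from
      \<open>y\<close>.\<close>
    ultimately have "t \<in>\<^sub>q y'" using y(1) y'(1) subst_mem_right by blast
    with \<open>t \<in>\<^sub>q y\<close> show False
      using y'(2) r(2) unfolding subq_def by blast
  qed
  then have "s =\<^sub>E y" using qs y by (auto simp: exteq_iff_qset subq_def)
  then have "qc U s =\<^sub>E qc U y" using qs y exteq_imp_ind qc_cong by blast
  then have "qc U s =\<^sub>E b" using qs y qb qc_qset by (simp add: exteq_iff_qset)
  with b show ?thesis unfolding eq_term_def by blast
qed

end

theorem theorem12:
  fixes U :: "'a qstruct" and x :: 'a
  assumes "Qsharp U"
    and "matom U x"
  shows "(\<exists>s. qset_language.is_pair U x x s) \<and>
    (\<forall>s. qset_language.is_pair U x x s \<longrightarrow>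
      qset_language.eq_term U (qc U s) (qset_language.is_one U))"
  using Qsharp.Q12[OF assms(1)] Qsharp.qc_sing[OF assms(1)] by blast

end
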